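(* Let $q,\alpha\in\mathbb{C}$ with $0<|q|<1$, let $m\in\mathbb{N}$ and $x,y\in\mathbb{C}$. Then for every $n\in\mathbb{N}_0$ both of the following identities hold: \[ \mathfrak{B}_{n,q}^{(\alpha)}(x,y)=\frac{1}{2m^{n}}\sum_{k=0}^{n}\begin{bmatrix} n \\ k \end{bmatrix}_q\left[m^{k}\mathfrak{B}_{k,q}^{(\alpha)}(x,0)+\sum_{j=0}^{k}\begin{bmatrix} k \\ j \end{bmatrix}_q m^{j}\mathfrak{B}_{j,q}^{(\alpha)}(x,-1)+[k]_q\sum_{j=0}^{k-1}\begin{bmatrix} k-1 \\ j \end{bmatrix}_q m^{j+1}\mathfrak{B}_{j,q}^{(\alpha-1)}(x,-1)\right]\mathfrak{E}_{n-k,q}(0,my), \] \[ \mathfrak{B}_{n,q}^{(\alpha)}(x,y)=\frac{1}{2m^{n}}\sum_{k=0}^{n}\begin{bmatrix} n \\ k \end{bmatrix}_q m^{k}\left[\mathfrak{B}_{k,q}^{(\alpha)}(0,y)+\sum_{j=0}^{k}\begin{bmatrix} k \\ j \end{bmatrix}_q\left(\tfrac1m-1\right)_q^{k-j}\mathfrak{B}_{j,q}^{(\alpha)}(0,y)+[k]_q\sum_{j=0}^{k-1}\begin{bmatrix} k-1 \\ j \end{bmatrix}_q\left(\tfrac1m-1\right)_q^{k-1-j}\mathfrak{B}_{j,q}^{(\alpha-1)}(0,y)\right]\mathfrak{E}_{n-k,q}(mx,0). \]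
   Context: $\mathbb{N}=\{1,2,\dots\}$, $\mathbb{N}_0=\mathbb{N}\cup\{0\}$. For $q\in\mathbb{C}$, $0<|q|<1$: $[n]_q=\frac{1-q^n}{1-q}$, $[0]_q!=1$, $[n]_q!=[1]_q[2]_q\cdots[n]_q$, and $\begin{bmatrix} n \\ k \end{bmatrix}_q=\frac{[n]_q!}{[k]_q![n-k]_q!}$ for $0\le k\le n$. For $n\in\mathbb{N}_0$, $(a+b)_q^{n}:=\sum_{k=0}^n\begin{bmatrix} n \\ k \end{bmatrix}_q q^{k(k-1)/2}a^{n-k}b^k$; thus $(\frac1m-1)_q^n$ is this expression with $a=\frac1m$, $b=-1$. Set $e_q(z)=\sum_{n\ge0}\frac{z^n}{[n]_q!}$ and $E_q(z)=\sum_{n\ge0}\frac{q^{n(n-1)/2}z^n}{[n]_q!}$. For $\alpha\in\mathbb{C}$ the $q$-Bernoulli and $q$-Euler polynomials of order $\alpha$ are defined by the power series expansions in $t$ around $0$ \[ \left(\frac{t}{e_q(t)-1}\right)^{\alpha}e_q(tx)E_q(ty)=\sum_{n=0}^\infty\mathfrak{B}_{n,q}^{(\alpha)}(x,y)\frac{t^n}{[n]_q!},\qquad \left(\frac{2}{e_q(t)+1}\right)^{\alpha}e_q(tx)E_q(ty)=\sum_{n=0}^\infty\mathfrak{E}_{n,q}^{(\alpha)}(x,y)\frac{t^n}{[n]_q!}, \] where the $\alpha$-th power of a power series with constant term $1$ is the one with constant term $1$. Write $\mathfrak{B}_{n,q}(x,y)=\mathfrak{B}_{n,q}^{(1)}(x,y)$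 and $\mathfrak{E}_{n,q}(x,y)=\mathfrak{E}_{n,q}^{(1)}(x,y)$. Empty sums are $0$ (so for $k=0$ the terms with factor $[k]_q$ vanish). *)

theory Defs
  imports Complex_Main "HOL-Computational_Algebra.Formal_Power_Series"
begin

definition q_num :: "complex \<Rightarrow> nat \<Rightarrow> complex" where
  "q_num q n = (1 - q ^ n) / (1 - q)"

definition q_fact :: "complex \<Rightarrow> nat \<Rightarrow> complex" where
  "q_fact q n = (\<Prod>i=1..n. q_num q i)"

text \<open>Only meaningful for \<open>k \<le> n\<close>, because of the truncated subtraction.\<close>

definition q_binom :: "complex \<Rightarrow> nat \<Rightarrow> nat \<Rightarrow> complex" where
  "q_binom q n k = q_fact q n / (q_fact q k * q_fact q (n - k))"

definition q_add_pow :: "complex \<Rightarrow> complex \<Rightarrow> complex \<Rightarrow> nat \<Rightarrow> complex" where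
  "q_add_pow q a b n = (\<Sum>k=0..n. q_binom q n k * q ^ (k * (k - 1) div 2) * a ^ (n - k) * b ^ k)"

definition q_exp :: "complex \<Rightarrow> complex fps" where
  "q_exp q = Abs_fps (\<lambda>n. 1 / q_fact q n)"

definition q_Exp :: "complex \<Rightarrow> complex fps" where
  "q_Exp q = Abs_fps (\<lambda>n. q ^ (n * (n - 1) div 2) / q_fact q n)"

text \<open>
  The power \<open>F\<^sup>\<alpha>\<close> of a series with constant term 1, as the binomial series
  \<open>(1 + X)\<^sup>\<alpha>\<close> composed with \<open>F - 1\<close>. The lemmas below show that it has constant term 1,
  satisfies the differential equation of the power (which, together with the constant
  term, determines it), and obeys the expected power laws.
\<close>

definition fps_cpow :: "complex fps \<Rightarrow> complex \<Rightarrow> complex fps" where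
  "fps_cpow F \<alpha> = fps_binomial \<alpha> oo (F - 1)"

lemma fps_cpow_nth_0: "fps_nth (fps_cpow F \<alpha>) 0 = 1"
  by (simp add: fps_cpow_def)

lemma fps_cpow_add:
  assumes "fps_nth F 0 = 1"
  shows "fps_cpow F (\<alpha> + \<beta>) = fps_cpow F \<alpha> * fps_cpow F \<beta>"
  using assms by (simp add: fps_cpow_def fps_binomial_add_mult fps_compose_mult_distrib)

lemma fps_cpow_of_nat:
  assumes "fps_nth F 0 = 1"
  shows "fps_cpow F (of_nat n) = F ^ n"
proof -
  have "fps_cpow F (of_nat n) = ((1 + fps_X) oo (F - 1)) ^ n"
    using assms by (simp add: fps_cpow_def fps_binomial_of_nat fps_compose_power)
  also have "(1 + fps_X) oo (F - 1) = F"
    using assms by (simp add: fps_compose_add_distrib)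
  finally show ?thesis .
qed

lemma fps_cpow_deriv:
  assumes "fps_nth F 0 = 1"
  shows "F * fps_deriv (fps_cpow F \<alpha>) = fps_const \<alpha> * fps_deriv F * fps_cpow F \<alpha>"
proof -
  have "(1 + fps_X) * fps_deriv (fps_binomial \<alpha>) = fps_const \<alpha> * fps_binomial \<alpha>"
    by (simp add: fps_binomial_deriv fps_divide_unit mult.commute mult.left_commute
          inverse_mult_eq_1')
  then have "((1 + fps_X) * fps_deriv (fps_binomial \<alpha>)) oo (F - 1)
      = (fps_const \<alpha> * fps_binomial \<alpha>) oo (F - 1)"
    by simp
  then have "F * (fps_deriv (fps_binomial \<alpha>) oo (F - 1)) = fps_const \<alpha> * fps_cpow F \<alpha>"
    using assms by (simp add: fps_compose_mult_distrib fps_compose_add_distrib fps_cpow_def)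
  then show ?thesis
    using assms by (simp add: fps_cpow_def fps_compose_deriv mult.assoc[symmetric])
qed

text \<open>
  The generating functions are formal power series in \<open>t = fps_X\<close>; the polynomials are
  their coefficients multiplied by \<open>[n]\<^sub>q!\<close>. Both numerator and denominator of
  \<open>t / (e\<^sub>q(t) - 1)\<close> have subdegree 1; the quotient is a power series with constant term 1.
\<close>

definition q_bernoulli_gf :: "complex \<Rightarrow> complex \<Rightarrow> complex \<Rightarrow> complex \<Rightarrow> complex fps" where
  "q_bernoulli_gf q \<alpha> x y =
     fps_cpow (fps_X / (q_exp q - 1)) \<alpha>
       * (q_exp q oo (fps_X * fps_const x)) * (q_Exp q oo (fps_X * fps_const y))"

definition q_bernoulli :: "complex \<Rightarrow> complex \<Rightarrow> nat \<Rightarrow> complex \<Rightarrow> complex \<Rightarrow> complex" where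
  "q_bernoulli q \<alpha> n x y = fps_nth (q_bernoulli_gf q \<alpha> x y) n * q_fact q n"

definition q_euler_gf :: "complex \<Rightarrow> complex \<Rightarrow> complex \<Rightarrow> complex \<Rightarrow> complex fps" where
  "q_euler_gf q \<alpha> x y =
     fps_cpow (2 / (q_exp q + 1)) \<alpha>
       * (q_exp q oo (fps_X * fps_const x)) * (q_Exp q oo (fps_X * fps_const y))"

definition q_euler :: "complex \<Rightarrow> complex \<Rightarrow> nat \<Rightarrow> complex \<Rightarrow> complex \<Rightarrow> complex" where
  "q_euler q \<alpha> n x y = fps_nth (q_euler_gf q \<alpha> x y) n * q_fact q n"

lemma q_fact_nonzero:
  assumes "norm q < 1"
  shows "q_fact q n \<noteq> 0"
proof -
  have "q ^ i \<noteq> 1" if "i \<ge> 1" for i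
  proof
    assume "q ^ i = 1"
    then have "norm q ^ i = 1" by (metis norm_one norm_power)
    moreover have "norm q ^ i < 1"
      using assms that by (simp add: power_less_one_iff)
    ultimately show False by simp
  qed
  moreover from this[of 1] have "q \<noteq> 1" by simp
  ultimately show ?thesis by (auto simp: q_fact_def q_num_def)
qed

lemma bernoulli_base_nth_0:
  assumes "norm q < 1"
  shows "fps_nth (fps_X / (q_exp q - 1)) 0 = 1"
proof -
  have ne: "fps_nth (q_exp q - 1) 1 = 1"
    using assms by (auto simp: q_exp_def q_fact_def q_num_def)
  have "fps_nth (q_exp q - 1) 0 = 0"
    by (simp add: q_exp_def q_fact_def)
  then have eq: "q_exp q - 1 = fps_X * fps_shift 1 (q_exp q - 1)"
    by (intro fps_ext) (simp add: fps_eq_iff)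
  have "fps_X / (q_exp q - 1) = 1 / fps_shift 1 (q_exp q - 1)"
    by (subst eq) simp
  then show ?thesis using ne
    by (simp add: fps_divide_unit)
qed

lemma euler_base_nth_0: "fps_nth (2 / (q_exp q + 1)) 0 = 1"
  by (simp add: q_exp_def q_fact_def fps_divide_unit fps_numeral_nth_0)

end

theory Submission
  imports Defs
begin

text \<open>
  Attach to a sequence \<open>a\<close> its \<open>q\<close>-exponential generating series
  \<open>\<Sum>n. a n * t^n / [n]\<^sub>q!\<close>. Convolution with \<open>q\<close>-binomial coefficients is then multiplication
  of series, multiplication of \<open>a n\<close> by \<open>c^n\<close> is the substitution \<open>t := c t\<close>, and
  the shift \<open>[n]\<^sub>q * a (n - 1)\<close> is multiplication by \<open>t\<close>. The generating
  series of the values at \<open>(x, y)\<close> is \<open>P\<^sup>\<alpha> e\<^sub>q(t x) E\<^sub>q(t y)\<close> with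
  \<open>P = t / (e\<^sub>q(t) - 1)\<close>.

  Both identities come from inserting the factor \<open>1 = (e\<^sub>q(t) + 1) / 2 * (2 / (e\<^sub>q(t) + 1))\<close>
  into this series, after \<open>t := m t\<close>. The factor \<open>2 / (e\<^sub>q(t) + 1)\<close> is absorbed into a
  \<open>q\<close>-Euler series, and what remains is to recognise the bracket as the other part multiplied
  by \<open>e\<^sub>q(t) + 1\<close>. Its first term is the summand 1. Its two sums give \<open>e\<^sub>q(t)\<close> through

    \<open>P\<^sup>\<alpha> F + t P\<^sup>\<alpha>\<^sup>-\<^sup>1 F = P\<^sup>\<alpha> F + (e\<^sub>q(t) - 1) P\<^sup>\<alpha> F = e\<^sub>q(t) P\<^sup>\<alpha> F\<close>

  (\<open>bernoulli_power_recurrence\<close>), applied to an \<open>F\<close> that contains the factor \<open>E\<^sub>q(-t)\<close>: this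
  factor is the inverse of \<open>e\<^sub>q(t)\<close> (\<open>q_exp_times_q_Exp_uminus\<close>), so both disappear. In the
  first identity \<open>E\<^sub>q(-t)\<close> is there because the second argument is \<open>-1\<close>; in the second
  it comes from \<open>(1/m - 1)\<^sub>q^n\<close>, whose generating series is \<open>e\<^sub>q(t/m) E\<^sub>q(-t)\<close>.
\<close>

section \<open>Substitution of a multiple of the variable\<close>

abbreviation dilate :: "complex \<Rightarrow> complex fps \<Rightarrow> complex fps" where
  "dilate c F \<equiv> F oo (fps_X * fps_const c)"

lemma dilate_nth: "fps_nth (dilate c F) n = c ^ n * fps_nth F n"
  by (subst mult.commute) (simp add: fps_compose_linear)

lemma dilate_mult: "dilate c (F * G) = dilate c F * dilate c G"
  by (simp add: fps_compose_mult_distrib)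

lemma dilate_dilate: "dilate c (dilate d F) = dilate (c * d) F"
  by (rule fps_ext) (simp add: dilate_nth power_mult_distrib)

lemma dilate_1: "dilate 1 F = F"
  by (rule fps_ext) (simp add: dilate_nth)

lemma dilate_fps_X: "dilate c fps_X = fps_X * fps_const c"
  by simp

section \<open>Generating series with q-factorial denominators\<close>

definition q_egf :: "complex \<Rightarrow> (nat \<Rightarrow> complex) \<Rightarrow> complex fps" where
  "q_egf q a = Abs_fps (\<lambda>n. a n / q_fact q n)"

lemma q_fact_Suc: "q_fact q (Suc n) = q_num q (Suc n) * q_fact q n"
  by (simp add: q_fact_def mult.commute)

lemma q_num_nonzero:
  assumes "norm q < 1"
  shows "q_num q (Suc n) \<noteq> 0"
  using q_fact_nonzero[OF assms, of "Suc n"] by (simp add: q_fact_Suc)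

lemma q_egf_inject:
  assumes "norm q < 1" and "q_egf q a = q_egf q b"
  shows "a n = b n"
proof -
  have "a n / q_fact q n = b n / q_fact q n"
    using arg_cong[OF assms(2), of "\<lambda>F. fps_nth F n"] by (simp add: q_egf_def)
  then show ?thesis using q_fact_nonzero[OF assms(1), of n] by simp
qed

lemma q_egf_add: "q_egf q (\<lambda>n. a n + b n) = q_egf q a + q_egf q b"
  by (rule fps_ext) (simp add: q_egf_def add_divide_distrib)

lemma q_egf_cmult: "q_egf q (\<lambda>n. c * a n) = fps_const c * q_egf q a"
  by (rule fps_ext) (simp add: q_egf_def)

lemma q_egf_power_mult: "q_egf q (\<lambda>n. c ^ n * a n) = dilate c (q_egf q a)"
  by (rule fps_ext) (simp add: q_egf_def dilate_nth)

lemma q_egf_convolution: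
  assumes "norm q < 1"
  shows "q_egf q (\<lambda>n. \<Sum>k=0..n. q_binom q n k * (a k * b (n - k))) = q_egf q a * q_egf q b"
  by (rule fps_ext)
     (use q_fact_nonzero[OF assms] in
       \<open>simp add: q_egf_def fps_mult_nth q_binom_def sum_divide_distrib\<close>)

lemma q_egf_shift:
  assumes "norm q < 1"
  shows "q_egf q (\<lambda>n. q_num q n * a (n - 1)) = fps_X * q_egf q a"
proof (rule fps_ext)
  fix n
  show "fps_nth (q_egf q (\<lambda>n. q_num q n * a (n - 1))) n = fps_nth (fps_X * q_egf q a) n"
    using q_num_nonzero[OF assms]
    by (cases n) (simp_all add: q_egf_def q_fact_Suc, simp add: q_num_def)
qed

text \<open>
  For \<open>k = 0\<close> the truncated \<open>k - 1\<close> is 0, where the unshifted convolution still has a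
  term; it is annihilated by \<open>[0]\<^sub>q = 0\<close>, in agreement with the empty sum over \<open>{..<k}\<close>.
\<close>
lemma q_egf_shifted_convolution:
  assumes "norm q < 1"
  shows "q_egf q (\<lambda>k. q_num q k * (\<Sum>j<k. q_binom q (k - 1) j * (a j * b (k - 1 - j))))
    = fps_X * (q_egf q a * q_egf q b)"
proof -
  let ?s = "\<lambda>n. \<Sum>j=0..n. q_binom q n j * (a j * b (n - j))"
  have "q_num q k * (\<Sum>j<k. q_binom q (k - 1) j * (a j * b (k - 1 - j)))
      = q_num q k * ?s (k - 1)" for k
    by (cases k) (simp_all add: q_num_def lessThan_Suc_atMost atMost_atLeast0)
  then show ?thesis
    by (simp only: q_egf_shift[OF assms, of ?s] q_egf_convolution[OF assms])
qed

lemma q_egf_const_1: "q_egf q (\<lambda>_. 1) = q_exp q"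
  by (simp add: q_egf_def q_exp_def)

lemma q_egf_bernoulli:
  assumes "norm q < 1"
  shows "q_egf q (\<lambda>n. q_bernoulli q \<alpha> n x y) = q_bernoulli_gf q \<alpha> x y"
  by (rule fps_ext) (simp add: q_egf_def q_bernoulli_def q_fact_nonzero[OF assms])

lemma q_egf_euler:
  assumes "norm q < 1"
  shows "q_egf q (\<lambda>n. q_euler q \<alpha> n x y) = q_euler_gf q \<alpha> x y"
  by (rule fps_ext) (simp add: q_egf_def q_euler_def q_fact_nonzero[OF assms])

lemma q_egf_q_add_pow:
  assumes "norm q < 1"
  shows "q_egf q (q_add_pow q a b) = dilate a (q_exp q) * dilate b (q_Exp q)"
proof -
  have a: "dilate a (q_exp q) = q_egf q (\<lambda>n. a ^ n)"
    by (rule fps_ext) (simp add: q_egf_def q_exp_def dilate_nth)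
  have b: "dilate b (q_Exp q) = q_egf q (\<lambda>n. q ^ (n * (n - 1) div 2) * b ^ n)"
    by (rule fps_ext) (simp add: q_egf_def q_Exp_def dilate_nth)
  have "q_add_pow q a b =
      (\<lambda>n. \<Sum>k=0..n. q_binom q n k * ((q ^ (k * (k - 1) div 2) * b ^ k) * a ^ (n - k)))"
    by (simp add: q_add_pow_def fun_eq_iff mult_ac)
  then have "q_egf q (q_add_pow q a b) = dilate b (q_Exp q) * dilate a (q_exp q)"
    unfolding a b by (simp only: q_egf_convolution[OF assms, where b = "\<lambda>n. a ^ n"])
  then show ?thesis by (simp only: mult.commute)
qed

section \<open>The two q-exponential series are inverse to each other\<close>

lemma dilate_q_exp:
  assumes "norm q < 1"
  shows "dilate q (q_exp q) = (1 - fps_const (1 - q) * fps_X) * q_exp q"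
proof (rule fps_ext)
  fix n
  have [simp]: "q \<noteq> 1" using assms by auto
  show "fps_nth (dilate q (q_exp q)) n
      = fps_nth ((1 - fps_const (1 - q) * fps_X) * q_exp q) n"
  proof (cases n)
    case (Suc k)
    have "(1 - q) / q_fact q k = (1 - q ^ Suc k) / q_fact q (Suc k)"
      using q_num_nonzero[OF assms, of k] q_fact_nonzero[OF assms, of k]
      by (simp add: q_fact_Suc q_num_def field_simps)
    then show ?thesis
      using Suc by (simp add: dilate_nth q_exp_def algebra_simps diff_divide_distrib)
  qed (simp add: dilate_nth q_exp_def)
qed

lemma q_Exp_dilate:
  assumes "norm q < 1"
  shows "q_Exp q = (1 + fps_const (1 - q) * fps_X) * dilate q (q_Exp q)"
proof (rule fps_ext)
  fix n
  have [simp]: "q \<noteq> 1" using assms by auto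
  show "fps_nth (q_Exp q) n = fps_nth ((1 + fps_const (1 - q) * fps_X) * dilate q (q_Exp q)) n"
  proof (cases n)
    case (Suc k)
    have tri: "Suc k * (Suc k - 1) div 2 = k + k * (k - 1) div 2"
      by (cases k) auto
    have fact: "(1 - q) / q_fact q k = (1 - q ^ Suc k) / q_fact q (Suc k)"
      using q_num_nonzero[OF assms, of k] q_fact_nonzero[OF assms, of k]
      by (simp add: q_fact_Suc q_num_def field_simps)
    let ?T = "q ^ (k + k * (k - 1) div 2)"
    have "fps_nth ((1 + fps_const (1 - q) * fps_X) * dilate q (q_Exp q)) n
        = ?T * (q ^ Suc k / q_fact q (Suc k) + (1 - q) / q_fact q k)"
      using Suc tri
      by (simp add: dilate_nth q_Exp_def ring_distribs mult_ac power_add)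
    also have "\<dots> = ?T / q_fact q (Suc k)"
      by (simp add: fact add_divide_distrib[symmetric])
    also have "\<dots> = fps_nth (q_Exp q) n"
      using Suc tri by (simp add: q_Exp_def)
    finally show ?thesis by simp
  qed (simp add: dilate_nth q_Exp_def)
qed

text \<open>
  The two functional equations in \<open>t := q t\<close> have mutually inverse multipliers, so the product
  is invariant under \<open>t := q t\<close>. As \<open>q\<close> is not a root of unity, an invariant series
  is constant.
\<close>
lemma q_exp_times_q_Exp_uminus:
  assumes "norm q < 1"
  shows "q_exp q * dilate (-1) (q_Exp q) = 1"
proof -
  let ?F = "q_exp q * dilate (-1) (q_Exp q)"
  let ?L = "1 - fps_const (1 - q) * fps_X :: complex fps"
  have "dilate (-1) (1 + fps_const (1 - q) * fps_X) = ?L"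
    by (rule fps_ext) (simp only: dilate_nth, simp add: fps_X_def)
  then have "dilate (-1) (q_Exp q) = ?L * dilate (-1) (dilate q (q_Exp q))"
    using arg_cong[OF q_Exp_dilate[OF assms], of "dilate (-1)"] by (simp only: dilate_mult)
  then have E: "dilate (-1) (q_Exp q) = ?L * dilate q (dilate (-1) (q_Exp q))"
    unfolding dilate_dilate by (simp only: mult.commute[of "-1" q])
  have "dilate q ?F = ?L * q_exp q * dilate q (dilate (-1) (q_Exp q))"
    by (simp only: dilate_mult dilate_q_exp[OF assms])
  also have "\<dots> = q_exp q * (?L * dilate q (dilate (-1) (q_Exp q)))"
    by (simp only: mult_ac)
  also have "\<dots> = ?F"
    by (simp only: E[symmetric])
  finally have inv: "dilate q ?F = ?F" .
  show ?thesis
  proof (rule fps_ext)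
    fix n
    show "fps_nth ?F n = fps_nth 1 n"
    proof (cases n)
      case 0
      then show ?thesis by (simp add: q_exp_def q_Exp_def q_fact_def)
    next
      case (Suc k)
      have "q ^ n * fps_nth ?F n = fps_nth ?F n"
        using arg_cong[OF inv, of "\<lambda>F. fps_nth F n"] by (simp only: dilate_nth)
      moreover have "q ^ n \<noteq> 1"
        using q_num_nonzero[OF assms, of k] Suc by (auto simp: q_num_def)
      ultimately show ?thesis using Suc by simp
    qed
  qed
qed

section \<open>Powers of the Bernoulli and Euler series\<close>

lemma bernoulli_base_mult:
  assumes "norm q < 1"
  shows "fps_X / (q_exp q - 1) * (q_exp q - 1) = fps_X"
proof -
  have 1: "fps_nth (q_exp q - 1) 1 \<noteq> 0"
    using assms by (auto simp: q_exp_def q_fact_def q_num_def)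
  then have "subdegree (q_exp q - 1) \<le> 1" and "q_exp q - 1 \<noteq> 0"
    by (rule subdegree_leI, auto)
  then have "(q_exp q - 1) dvd fps_X"
    by (simp add: fps_dvd_iff)
  then show ?thesis by (rule dvd_div_mult_self)
qed

text \<open>
  Lowering the order by 1 divides by \<open>P\<close>, and \<open>t / P = e\<^sub>q(t) - 1\<close>.
\<close>
lemma bernoulli_power_recurrence:
  assumes "norm q < 1"
  defines "P \<equiv> fps_X / (q_exp q - 1)"
  shows "fps_cpow P \<alpha> * F + fps_X * (fps_cpow P (\<alpha> - 1) * F) = q_exp q * (fps_cpow P \<alpha> * F)"
proof -
  have P0: "fps_nth P 0 = 1"
    unfolding P_def by (rule bernoulli_base_nth_0[OF assms(1)])
  have "fps_cpow P \<alpha> = fps_cpow P (\<alpha> - 1) * P"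
    using fps_cpow_add[OF P0, of "\<alpha> - 1" 1] fps_cpow_of_nat[OF P0, of 1] by simp
  moreover have "P * (q_exp q - 1) = fps_X"
    unfolding P_def by (rule bernoulli_base_mult[OF assms(1)])
  ultimately have "fps_X * fps_cpow P (\<alpha> - 1) = fps_cpow P \<alpha> * (q_exp q - 1)"
    by (metis mult.assoc mult.commute)
  then have "fps_X * (fps_cpow P (\<alpha> - 1) * F) = fps_cpow P \<alpha> * (q_exp q - 1) * F"
    by (metis mult.assoc)
  then show ?thesis by (simp add: algebra_simps)
qed

lemma euler_gf_mult:
  "(q_exp q + 1) * q_euler_gf q 1 x y = 2 * (dilate x (q_exp q) * dilate y (q_Exp q))"
proof -
  have "fps_cpow (2 / (q_exp q + 1)) 1 = 2 / (q_exp q + 1)"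
    using fps_cpow_of_nat[OF euler_base_nth_0, of q 1] by simp
  moreover have "(q_exp q + 1) * (2 / (q_exp q + 1)) = 2"
    by (simp add: fps_divide_unit q_exp_def q_fact_def inverse_mult_eq_1'
        mult.left_commute[of _ 2])
  ultimately show ?thesis
    by (simp add: q_euler_gf_def mult.assoc[symmetric])
qed

lemma dilate_0_q_exp: "dilate 0 (q_exp q) = 1"
  by (rule fps_ext) (simp add: dilate_nth q_exp_def q_fact_def)

lemma dilate_0_q_Exp: "dilate 0 (q_Exp q) = 1"
  by (rule fps_ext) (simp add: dilate_nth q_Exp_def q_fact_def)

lemma bernoulli_gf_split_Exp:
  "q_bernoulli_gf q \<alpha> x y = q_bernoulli_gf q \<alpha> x 0 * dilate y (q_Exp q)"
  unfolding q_bernoulli_gf_def dilate_0_q_Exp by (simp only: mult_1_right)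

lemma bernoulli_gf_split_exp:
  "q_bernoulli_gf q \<alpha> x y = q_bernoulli_gf q \<alpha> 0 y * dilate x (q_exp q)"
  unfolding q_bernoulli_gf_def dilate_0_q_exp by (simp only: mult_1_left mult_1_right mult_ac)

text \<open>
  Multiplication by \<open>E\<^sub>q(-t)\<close> followed by the recurrence restores the original series. The
  factor \<open>H\<close> leaves room for \<open>e\<^sub>q(t/m)\<close>.
\<close>
lemma bernoulli_gf_order_reduction:
  assumes "norm q < 1"
  shows "q_bernoulli_gf q \<alpha> x y * (H * dilate (-1) (q_Exp q))
       + fps_X * (q_bernoulli_gf q (\<alpha> - 1) x y * (H * dilate (-1) (q_Exp q)))
     = q_bernoulli_gf q \<alpha> x y * H"
proof -
  let ?P = "fps_X / (q_exp q - 1)"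
  let ?G = "dilate x (q_exp q) * dilate y (q_Exp q) * H"
  let ?F = "?G * dilate (-1) (q_Exp q)"
  have "q_exp q * (fps_cpow ?P \<alpha> * ?F)
      = fps_cpow ?P \<alpha> * ?G * (q_exp q * dilate (-1) (q_Exp q))"
    by (simp only: mult_ac)
  then have "q_exp q * (fps_cpow ?P \<alpha> * ?F) = fps_cpow ?P \<alpha> * ?G"
    by (simp only: q_exp_times_q_Exp_uminus[OF assms] mult_1_right)
  then show ?thesis
    using bernoulli_power_recurrence[OF assms, of \<alpha> ?F]
    unfolding q_bernoulli_gf_def by (simp only: mult.assoc)
qed

section \<open>The identities for the generating series\<close>

text \<open>
  Under \<open>t := c t\<close> the factor \<open>E\<^sub>q(t y)\<close> becomes \<open>E\<^sub>q(t c y)\<close>, which belongs to the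
  \<open>q\<close>-Euler series at \<open>(0, c y)\<close>. The denominator \<open>e\<^sub>q(t) + 1\<close> of that series is in the
  undilated variable, so the \<open>e\<^sub>q(t)\<close> in the bracket stands outside the dilations.
\<close>
lemma bernoulli_gf_euler_gf_second_argument:
  assumes "norm q < 1"
  shows "2 * dilate c (q_bernoulli_gf q \<alpha> x y)
    = (dilate c (q_bernoulli_gf q \<alpha> x 0)
       + (dilate c (q_bernoulli_gf q \<alpha> x (-1)) * q_exp q
          + fps_X * (fps_const c * dilate c (q_bernoulli_gf q (\<alpha> - 1) x (-1)) * q_exp q)))
      * q_euler_gf q 1 0 (c * y)"
proof -
  have "q_bernoulli_gf q \<alpha> x 0
      = q_bernoulli_gf q \<alpha> x (-1) + fps_X * q_bernoulli_gf q (\<alpha> - 1) x (-1)"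
    using bernoulli_gf_order_reduction[OF assms, of \<alpha> x 0 1]
    by (simp only: bernoulli_gf_split_Exp[symmetric] mult_1_left mult_1_right)
  then have red: "dilate c (q_bernoulli_gf q \<alpha> x 0)
      = dilate c (q_bernoulli_gf q \<alpha> x (-1))
        + fps_X * fps_const c * dilate c (q_bernoulli_gf q (\<alpha> - 1) x (-1))"
    by (simp only: fps_compose_add_distrib dilate_mult dilate_fps_X)
  have bracket: "dilate c (q_bernoulli_gf q \<alpha> x 0)
       + (dilate c (q_bernoulli_gf q \<alpha> x (-1)) * q_exp q
          + fps_X * (fps_const c * dilate c (q_bernoulli_gf q (\<alpha> - 1) x (-1)) * q_exp q))
     = dilate c (q_bernoulli_gf q \<alpha> x 0) * (q_exp q + 1)"
    unfolding distrib_left mult_1_right by (subst (2) red) (simp add: algebra_simps)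
  have "2 * dilate c (q_bernoulli_gf q \<alpha> x y)
      = dilate c (q_bernoulli_gf q \<alpha> x 0) * (2 * dilate (c * y) (q_Exp q))"
    by (subst bernoulli_gf_split_Exp) (simp only: dilate_mult dilate_dilate mult_ac)
  also have "\<dots> = dilate c (q_bernoulli_gf q \<alpha> x 0)
      * ((q_exp q + 1) * q_euler_gf q 1 0 (c * y))"
    by (simp only: euler_gf_mult dilate_0_q_exp mult_1_left)
  finally show ?thesis
    unfolding bracket by (simp only: mult.assoc)
qed

text \<open>
  Here the whole bracket is dilated: \<open>A\<close> contributes \<open>e\<^sub>q(t/c)\<close>, chosen so that
  \<open>t := c t\<close> turns it into the \<open>e\<^sub>q(t)\<close> that the \<open>q\<close>-Euler series needs.
\<close>
lemma bernoulli_gf_euler_gf_first_argument: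
  assumes "norm q < 1" and "c \<noteq> 0"
  defines "A \<equiv> dilate (1 / c) (q_exp q) * dilate (-1) (q_Exp q)"
  shows "2 * dilate c (q_bernoulli_gf q \<alpha> x y)
    = dilate c (q_bernoulli_gf q \<alpha> 0 y
       + (q_bernoulli_gf q \<alpha> 0 y * A + fps_X * (q_bernoulli_gf q (\<alpha> - 1) 0 y * A)))
      * q_euler_gf q 1 (c * x) 0"
proof -
  have "dilate c (q_bernoulli_gf q \<alpha> 0 y
        + (q_bernoulli_gf q \<alpha> 0 y * A + fps_X * (q_bernoulli_gf q (\<alpha> - 1) 0 y * A)))
      = dilate c (q_bernoulli_gf q \<alpha> 0 y)
        + dilate c (q_bernoulli_gf q \<alpha> 0 y) * dilate (c * (1 / c)) (q_exp q)"
    unfolding A_def bernoulli_gf_order_reduction[OF assms(1)]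
    by (simp only: fps_compose_add_distrib dilate_mult dilate_dilate)
  also have "\<dots> = dilate c (q_bernoulli_gf q \<alpha> 0 y) * (q_exp q + 1)"
    using assms(2) by (simp add: dilate_1 distrib_left add.commute)
  finally have bracket: "dilate c (q_bernoulli_gf q \<alpha> 0 y
        + (q_bernoulli_gf q \<alpha> 0 y * A + fps_X * (q_bernoulli_gf q (\<alpha> - 1) 0 y * A)))
      = dilate c (q_bernoulli_gf q \<alpha> 0 y) * (q_exp q + 1)" .
  have "2 * dilate c (q_bernoulli_gf q \<alpha> x y)
      = dilate c (q_bernoulli_gf q \<alpha> 0 y) * (2 * dilate (c * x) (q_exp q))"
    by (subst bernoulli_gf_split_exp) (simp only: dilate_mult dilate_dilate mult_ac)
  also have "\<dots> = dilate c (q_bernoulli_gf q \<alpha> 0 y)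
      * ((q_exp q + 1) * q_euler_gf q 1 (c * x) 0)"
    by (simp only: euler_gf_mult dilate_0_q_Exp mult_1_right)
  finally show ?thesis
    unfolding bracket by (simp only: mult.assoc)
qed

section \<open>The identities for the coefficients\<close>

text \<open>Comparison of coefficients, with an arbitrary sequence \<open>a\<close> in the role of the bracket.\<close>
lemma bernoulli_convolution_from_gf:
  assumes q: "norm q < 1" and c: "c \<noteq> 0"
    and gf: "2 * dilate c (q_bernoulli_gf q \<alpha> x y) = q_egf q a * q_euler_gf q 1 u v"
  shows "q_bernoulli q \<alpha> n x y
    = 1 / (2 * c ^ n) * (\<Sum>k=0..n. q_binom q n k * (a k * q_euler q 1 (n - k) u v))"
proof -
  have "q_egf q (\<lambda>n. 2 * (c ^ n * q_bernoulli q \<alpha> n x y)) = 2 * dilate c (q_bernoulli_gf q \<alpha> x y)"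
    by (simp only: q_egf_cmult q_egf_power_mult q_egf_bernoulli[OF q] numeral_fps_const)
  also have "\<dots> = q_egf q (\<lambda>n. \<Sum>k=0..n. q_binom q n k * (a k * q_euler q 1 (n - k) u v))"
    by (simp only: gf q_egf_convolution[OF q, where b = "\<lambda>n. q_euler q 1 n u v"]
        q_egf_euler[OF q])
  finally have "2 * (c ^ n * q_bernoulli q \<alpha> n x y)
      = (\<Sum>k=0..n. q_binom q n k * (a k * q_euler q 1 (n - k) u v))"
    by (rule q_egf_inject[OF q])
  then show ?thesis using c by (simp add: field_simps)
qed

theorem theorem8:
  fixes q \<alpha> x y :: complex and m n :: nat
  assumes "0 < norm q" and "norm q < 1" and "m \<ge> 1"
  shows
    "q_bernoulli q \<alpha> n x y =
       1 / (2 * of_nat m ^ n) *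
       (\<Sum>k=0..n. q_binom q n k *
          (of_nat m ^ k * q_bernoulli q \<alpha> k x 0
           + (\<Sum>j=0..k. q_binom q k j * of_nat m ^ j * q_bernoulli q \<alpha> j x (-1))
           + q_num q k *
             (\<Sum>j<k. q_binom q (k - 1) j * of_nat m ^ (j + 1) * q_bernoulli q (\<alpha> - 1) j x (-1)))
          * q_euler q 1 (n - k) 0 (of_nat m * y))
     \<and>
     q_bernoulli q \<alpha> n x y =
       1 / (2 * of_nat m ^ n) *
       (\<Sum>k=0..n. q_binom q n k * of_nat m ^ k *
          (q_bernoulli q \<alpha> k 0 y
           + (\<Sum>j=0..k. q_binom q k j * q_add_pow q (1 / of_nat m) (-1) (k - j)
                * q_bernoulli q \<alpha> j 0 y)
           + q_num q k *
             (\<Sum>j<k. q_binom q (k - 1) j * q_add_pow q (1 / of_nat m) (-1) (k - 1 - j)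
                * q_bernoulli q (\<alpha> - 1) j 0 y))
          * q_euler q 1 (n - k) (of_nat m * x) 0)"
proof -
  note q = assms(2)
  define c where "c = (of_nat m :: complex)"
  have c: "c \<noteq> 0" using assms(3) by (simp add: c_def)

  \<comment> \<open>The constant sequence 1, whose series is \<open>e\<^sub>q(t)\<close>, is the second convolution factor.\<close>
  define a1 where "a1 = (\<lambda>k. c ^ k * q_bernoulli q \<alpha> k x 0
      + ((\<Sum>j=0..k. q_binom q k j * (c ^ j * q_bernoulli q \<alpha> j x (-1) * 1))
      + q_num q k *
        (\<Sum>j<k. q_binom q (k - 1) j * (c * (c ^ j * q_bernoulli q (\<alpha> - 1) j x (-1)) * 1))))"
  have "q_egf q a1 = dilate c (q_bernoulli_gf q \<alpha> x 0)
      + (dilate c (q_bernoulli_gf q \<alpha> x (-1)) * q_exp q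
         + fps_X * (fps_const c * dilate c (q_bernoulli_gf q (\<alpha> - 1) x (-1)) * q_exp q))"
    unfolding a1_def q_egf_add q_egf_convolution[OF q, where b = "\<lambda>_. 1"]
      q_egf_shifted_convolution[OF q, where b = "\<lambda>_. 1"] q_egf_const_1 q_egf_cmult
      q_egf_power_mult q_egf_bernoulli[OF q] ..
  then have first: "q_bernoulli q \<alpha> n x y
      = 1 / (2 * c ^ n) * (\<Sum>k=0..n. q_binom q n k * (a1 k * q_euler q 1 (n - k) 0 (c * y)))"
    by (intro bernoulli_convolution_from_gf[OF q c])
       (simp only: bernoulli_gf_euler_gf_second_argument[OF q])

  let ?p = "q_add_pow q (1 / c) (-1)"
  define a2 where "a2 = (\<lambda>k. q_bernoulli q \<alpha> k 0 y
      + ((\<Sum>j=0..k. q_binom q k j * (q_bernoulli q \<alpha> j 0 y * ?p (k - j)))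
      + q_num q k *
        (\<Sum>j<k. q_binom q (k - 1) j * (q_bernoulli q (\<alpha> - 1) j 0 y * ?p (k - 1 - j)))))"
  let ?A = "dilate (1 / c) (q_exp q) * dilate (-1) (q_Exp q)"
  have "q_egf q a2 = q_bernoulli_gf q \<alpha> 0 y
      + (q_bernoulli_gf q \<alpha> 0 y * ?A + fps_X * (q_bernoulli_gf q (\<alpha> - 1) 0 y * ?A))"
    unfolding a2_def q_egf_add q_egf_convolution[OF q, where b = ?p]
      q_egf_shifted_convolution[OF q, where b = ?p] q_egf_q_add_pow[OF q]
      q_egf_bernoulli[OF q] ..
  then have "2 * dilate c (q_bernoulli_gf q \<alpha> x y)
      = q_egf q (\<lambda>k. c ^ k * a2 k) * q_euler_gf q 1 (c * x) 0"
    by (simp only: q_egf_power_mult bernoulli_gf_euler_gf_first_argument[OF q c])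
  then have second: "q_bernoulli q \<alpha> n x y
      = 1 / (2 * c ^ n)
        * (\<Sum>k=0..n. q_binom q n k * (c ^ k * a2 k * q_euler q 1 (n - k) (c * x) 0))"
    by (rule bernoulli_convolution_from_gf[OF q c])

  show ?thesis
    unfolding c_def[symmetric]
    by (rule conjI, subst first, simp add: a1_def mult_ac add.assoc,
        subst second, simp add: a2_def mult_ac add.assoc)
qed

end
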